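(* Let $R\subseteq S$ be reduced rings ($R$ a subring of $S$) where $S$ is weakly Baer. For $r\in R$ let $e(r)\in\mathbf{B}(S)$ be the idempotent with $\mathrm{ann}_S\, r=e(r)S$. Let $T\subseteq S$ be the subring generated by $R$ and the idempotents $e(r)$, $r\in R$. Then $T$ is weakly Baer.
   Context: All rings are unitary (not necessarily commutative) and reduced (no non-zero nilpotent elements). In a reduced ring $S$ all idempotents are central and left and right annihilators of an element $s$ coincide, denoted $\mathrm{ann}_S\, s$. $\mathbf{B}(S)$ denotes the set of idempotents of $S$. A reduced ring $S$ is weakly Baer if for each $s\in S$ there is $e\in\mathbf{B}(S)$ with $\mathrm{ann}_S\, s=eS$ (such $e$ is unique). *)

theory Defs
  imports "HOL-Algebra.Algebra"
begin

text \<open>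
  The exponent may be 0 in \<open>reduced\<close>: \<open>x [^] 0 = \<one> = \<zero>\<close> only happens in the zero ring, where
  the conclusion holds anyway.
\<close>

locale reduced_ring = ring R for R (structure) +
  assumes reduced: "\<lbrakk> x \<in> carrier R; x [^] (n::nat) = \<zero> \<rbrakk> \<Longrightarrow> x = \<zero>"

definition idempotents :: "('a, 'b) ring_scheme \<Rightarrow> 'a set"
  where "idempotents R = {e \<in> carrier R. e \<otimes>\<^bsub>R\<^esub> e = e}"

text \<open>
  The right annihilator; by \<open>annihilator_left\<close> below it is also the left annihilator
  when the ring is reduced.
\<close>

definition annihilator :: "('a, 'b) ring_scheme \<Rightarrow> 'a \<Rightarrow> 'a set"
  where "annihilator R s = {x \<in> carrier R. s \<otimes>\<^bsub>R\<^esub> x = \<zero>\<^bsub>R\<^esub>}"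

locale weakly_Baer = reduced_ring +
  assumes ann_idempotent:
    "s \<in> carrier R \<Longrightarrow> \<exists>e \<in> idempotents R. annihilator R s = e <# carrier R"

lemma (in reduced_ring) square_zero:
  assumes "x \<in> carrier R" "x \<otimes> x = \<zero>"
  shows "x = \<zero>"
  using reduced[of x 2] assms by (simp add: numeral_2_eq_2)

lemma (in reduced_ring) annihilator_left:
  assumes s: "s \<in> carrier R"
  shows "annihilator R s = {x \<in> carrier R. x \<otimes> s = \<zero>}"
proof -
  have *: "b \<otimes> a = \<zero>" if "a \<in> carrier R" "b \<in> carrier R" "a \<otimes> b = \<zero>" for a b
  proof (rule square_zero)
    have "(b \<otimes> a) \<otimes> (b \<otimes> a) = b \<otimes> (a \<otimes> b) \<otimes> a"
      using that(1,2) by (simp add: m_assoc)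
    then show "(b \<otimes> a) \<otimes> (b \<otimes> a) = \<zero>" using that by simp
  qed (use that in simp)
  then show ?thesis using s by (auto simp: annihilator_def)
qed

text \<open>Hence the idempotent in \<open>ann_idempotent\<close> is unique.\<close>

lemma (in reduced_ring) idempotent_unique:
  assumes e: "e \<in> idempotents R" and f: "f \<in> idempotents R"
    and eq: "e <# carrier R = f <# carrier R"
  shows "e = f"
proof -
  have ec: "e \<in> carrier R" "e \<otimes> e = e" and fc: "f \<in> carrier R" "f \<otimes> f = f"
    using e f by (auto simp: idempotents_def)
  have "e \<in> f <# carrier R" "f \<in> e <# carrier R"
  proof -
    have "e \<in> e <# carrier R" using ec by (auto simp: l_coset_def intro!: bexI[of _ e])
    moreover have "f \<in> f <# carrier R" using fc by (auto simp: l_coset_def intro!: bexI[of _ f])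
    ultimately show "e \<in> f <# carrier R" "f \<in> e <# carrier R" using eq by auto
  qed
  then obtain x y where "x \<in> carrier R" "e = f \<otimes> x" "y \<in> carrier R" "f = e \<otimes> y"
    by (auto simp: l_coset_def)
  then have fe: "f \<otimes> e = e" and ef: "e \<otimes> f = f"
    using ec(2) fc(2) m_assoc[OF fc(1) fc(1), of x] m_assoc[OF ec(1) ec(1), of y] by auto
  have "(e \<ominus> f) \<otimes> e = \<zero>" "(e \<ominus> f) \<otimes> f = \<zero>"
    using ec fc fe ef by (simp_all add: a_minus_def l_distr l_minus r_neg)
  then have "(e \<ominus> f) \<otimes> (e \<ominus> f) = \<zero>"
    using ec(1) fc(1) by (simp add: a_minus_def r_distr r_minus)
  then have "e \<ominus> f = \<zero>" using square_zero[of "e \<ominus> f"] ec(1) fc(1) by simp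
  then show ?thesis using ec(1) fc(1) by simp
qed

end

theory Submission
  imports Defs
begin

text \<open>
  Gluing \<open>x\<close> and \<open>y\<close> along a central idempotent \<open>f\<close>, i.e. forming \<open>f x + (1 - f) y\<close>, commutes with
  the ring operations. Hence the elements obtained from \<open>R\<close> by repeatedly gluing along idempotents
  \<open>e(r)\<close> form a subring, which contains \<open>e(r)\<close> as the gluing of \<open>1\<close> and \<open>0\<close> along itself, and so
  contains \<open>T\<close>. Gluing also commutes with annihilators: if \<open>g\<close> and \<open>h\<close> generate the annihilators
  of \<open>x\<close> and \<open>y\<close>, then \<open>f g + (1 - f) h\<close> generates that of \<open>f x + (1 - f) y\<close>. By induction every
  element of \<open>T\<close> has its annihilator generated by an idempotent that lies in \<open>T\<close>.
\<close>

section \<open>Idempotents and their complements\<close>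

lemma idempotentsD:
  assumes "e \<in> idempotents R"
  shows "e \<in> carrier R" "e \<otimes>\<^bsub>R\<^esub> e = e"
  using assms by (auto simp: idempotents_def)

lemma (in ring) idempotent_compl:
  assumes "f \<in> idempotents R"
  shows "\<one> \<ominus> f \<in> carrier R" "f \<otimes> (\<one> \<ominus> f) = \<zero>" "(\<one> \<ominus> f) \<otimes> f = \<zero>"
    "\<one> \<ominus> f \<in> idempotents R"
proof -
  note f = idempotentsD[OF assms]
  show c: "\<one> \<ominus> f \<in> carrier R" using f by simp
  show z: "f \<otimes> (\<one> \<ominus> f) = \<zero>" "(\<one> \<ominus> f) \<otimes> f = \<zero>"
    using f by (simp_all add: a_minus_def l_distr r_distr l_minus r_minus r_neg)
  have "(\<one> \<ominus> f) \<otimes> (\<one> \<ominus> f) = \<one> \<ominus> f"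
    using f c z l_distr[of \<one> "\<ominus> f" "\<one> \<ominus> f"]
    by (simp add: a_minus_def l_minus)
  then show "\<one> \<ominus> f \<in> idempotents R"
    using c by (simp add: idempotents_def)
qed

lemma (in ring) idempotent_decomp:
  assumes "f \<in> carrier R" "x \<in> carrier R"
  shows "f \<otimes> x \<oplus> (\<one> \<ominus> f) \<otimes> x = x"
proof -
  have "f \<oplus> (\<one> \<ominus> f) = \<one>"
    using assms(1) by (simp add: a_minus_def a_comm[of f] a_assoc l_neg)
  then show ?thesis
    using assms by (simp flip: l_distr)
qed

text \<open>The corners \<open>e x (1 - e)\<close> and \<open>(1 - e) x e\<close> have square zero
  because \<open>e\<close> and \<open>1 - e\<close> annihilate each other. Reducedness kills both,
  so \<open>e x = e x e = x e\<close>.\<close>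

lemma (in reduced_ring) idempotent_central:
  assumes "e \<in> idempotents R" "x \<in> carrier R"
  shows "e \<otimes> x = x \<otimes> e"
proof -
  note e = idempotentsD[OF assms(1)] and c = idempotent_compl[OF assms(1)]
  let ?g = "\<one> \<ominus> e"
  have "e \<otimes> x \<otimes> ?g = \<zero>"
  proof (rule square_zero)
    have "(e \<otimes> x \<otimes> ?g) \<otimes> (e \<otimes> x \<otimes> ?g) = e \<otimes> x \<otimes> (?g \<otimes> e) \<otimes> (x \<otimes> ?g)"
      using e(1) c(1) assms(2) by (simp add: m_assoc)
    then show "(e \<otimes> x \<otimes> ?g) \<otimes> (e \<otimes> x \<otimes> ?g) = \<zero>"
      using e(1) c(1,3) assms(2) by simp
  qed (use e(1) c(1) assms(2) in simp)
  moreover have "?g \<otimes> x \<otimes> e = \<zero>"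
  proof (rule square_zero)
    have "(?g \<otimes> x \<otimes> e) \<otimes> (?g \<otimes> x \<otimes> e) = ?g \<otimes> x \<otimes> (e \<otimes> ?g) \<otimes> (x \<otimes> e)"
      using e(1) c(1) assms(2) by (simp add: m_assoc)
    then show "(?g \<otimes> x \<otimes> e) \<otimes> (?g \<otimes> x \<otimes> e) = \<zero>"
      using e(1) c(1,2) assms(2) by simp
  qed (use e(1) c(1) assms(2) in simp)
  ultimately have "e \<otimes> x \<ominus> e \<otimes> x \<otimes> e = \<zero>" "x \<otimes> e \<ominus> e \<otimes> x \<otimes> e = \<zero>"
    using e(1) assms(2) by (simp_all add: a_minus_def l_distr r_distr l_minus r_minus)
  then show ?thesis
    using e(1) assms(2) by simp
qed

lemma (in reduced_ring) idempotent_left_commute: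
  assumes "e \<in> idempotents R" "x \<in> carrier R" "y \<in> carrier R"
  shows "e \<otimes> (x \<otimes> y) = x \<otimes> (e \<otimes> y)"
  using idempotentsD(1)[OF assms(1)] assms(2,3) idempotent_central[OF assms(1,2)]
  by (simp flip: m_assoc)

section \<open>Gluing and the ring operations\<close>

definition glue :: "('a, 'b) ring_scheme \<Rightarrow> 'a \<Rightarrow> 'a \<Rightarrow> 'a \<Rightarrow> 'a"
  where "glue R f x y = f \<otimes>\<^bsub>R\<^esub> x \<oplus>\<^bsub>R\<^esub> (\<one>\<^bsub>R\<^esub> \<ominus>\<^bsub>R\<^esub> f) \<otimes>\<^bsub>R\<^esub> y"

context ring
begin

lemma glue_closed [simp]:
  assumes "f \<in> carrier R" "x \<in> carrier R" "y \<in> carrier R"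
  shows "glue R f x y \<in> carrier R"
  using assms by (simp add: glue_def)

lemma glue_minus:
  assumes "f \<in> carrier R" "x \<in> carrier R" "y \<in> carrier R"
  shows "\<ominus> glue R f x y = glue R f (\<ominus> x) (\<ominus> y)"
  using assms by (simp add: glue_def minus_add r_minus)

lemma glue_mult_right:
  assumes "f \<in> carrier R" "x \<in> carrier R" "y \<in> carrier R" "w \<in> carrier R"
  shows "glue R f x y \<otimes> w = glue R f (x \<otimes> w) (y \<otimes> w)"
  using assms by (simp add: glue_def l_distr m_assoc)

text \<open>The element \<open>w\<close> is the gluing of \<open>w\<close> with itself, by
  \<open>idempotent_decomp\<close>, so adding it amounts to adding it to both components.\<close>

lemma glue_add:
  assumes "f \<in> carrier R" "x \<in> carrier R" "y \<in> carrier R" "w \<in> carrier R"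
  shows "glue R f x y \<oplus> w = glue R f (x \<oplus> w) (y \<oplus> w)"
proof -
  have "glue R f (x \<oplus> w) (y \<oplus> w) = glue R f x y \<oplus> (f \<otimes> w \<oplus> (\<one> \<ominus> f) \<otimes> w)"
    using assms by (simp add: glue_def r_distr a_ac)
  then show ?thesis
    using assms by (simp add: idempotent_decomp)
qed

lemma idempotent_mult_glue:
  assumes f: "f \<in> idempotents R" and c: "x \<in> carrier R" "y \<in> carrier R"
  shows "f \<otimes> glue R f x y = f \<otimes> x" "(\<one> \<ominus> f) \<otimes> glue R f x y = (\<one> \<ominus> f) \<otimes> y"
  using idempotentsD[OF f] idempotent_compl[OF f] idempotentsD(2)[OF idempotent_compl(4)[OF f]] c
  by (simp_all add: glue_def r_distr flip: m_assoc)

text \<open>An element is the sum of its products with \<open>f\<close> and \<open>1 - f\<close>, so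
  these two components determine it. Later equations about gluings are checked on each component
  separately.\<close>

lemma glue_eq_iff:
  assumes f: "f \<in> idempotents R" and c: "x \<in> carrier R" "y \<in> carrier R" "w \<in> carrier R"
  shows "glue R f x y = w \<longleftrightarrow> f \<otimes> x = f \<otimes> w \<and> (\<one> \<ominus> f) \<otimes> y = (\<one> \<ominus> f) \<otimes> w"
proof
  assume "glue R f x y = w"
  then show "f \<otimes> x = f \<otimes> w \<and> (\<one> \<ominus> f) \<otimes> y = (\<one> \<ominus> f) \<otimes> w"
    using idempotent_mult_glue[OF f c(1,2)] by simp
next
  assume "f \<otimes> x = f \<otimes> w \<and> (\<one> \<ominus> f) \<otimes> y = (\<one> \<ominus> f) \<otimes> w"
  then show "glue R f x y = w"
    using idempotent_decomp[OF idempotentsD(1)[OF f] c(3)] by (simp add: glue_def)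
qed

section \<open>Annihilators generated by an idempotent\<close>

lemma mem_idempotent_coset_iff:
  assumes "g \<in> idempotents R" "z \<in> carrier R"
  shows "z \<in> g <# carrier R \<longleftrightarrow> g \<otimes> z = z"
proof
  note g = idempotentsD[OF assms(1)]
  assume "z \<in> g <# carrier R"
  then obtain x where "x \<in> carrier R" "z = g \<otimes> x" by (auto simp: l_coset_def)
  then show "g \<otimes> z = z" using g by (simp flip: m_assoc)
next
  assume "g \<otimes> z = z"
  then show "z \<in> g <# carrier R" using assms(2) by (force simp: l_coset_def)
qed

text \<open>The coset of \<open>g\<close> consists of the elements fixed by left multiplication with
  \<open>g\<close>. This turns an equality of sets into a condition on single elements, which can be
  tested on components and restricts to subrings.\<close>

lemma annihilator_eq_coset_iff:
  assumes "g \<in> idempotents R"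
  shows "annihilator R t = g <# carrier R \<longleftrightarrow> (\<forall>z \<in> carrier R. t \<otimes> z = \<zero> \<longleftrightarrow> g \<otimes> z = z)"
proof -
  have "g <# carrier R \<subseteq> carrier R"
    using idempotentsD[OF assms] by (auto simp: l_coset_def)
  then have "annihilator R t = g <# carrier R \<longleftrightarrow>
      (\<forall>z \<in> carrier R. z \<in> annihilator R t \<longleftrightarrow> z \<in> g <# carrier R)"
    by (auto simp: annihilator_def)
  then show ?thesis
    using mem_idempotent_coset_iff[OF assms] by (auto simp: annihilator_def)
qed

end

section \<open>Gluing in a reduced ring\<close>

context reduced_ring
begin

text \<open>Here \<open>w\<close> has to pass \<open>f\<close> and \<open>1 - f\<close>, which are
  central by reducedness.\<close>

lemma glue_mult_left:
  assumes f: "f \<in> idempotents R" and c: "x \<in> carrier R" "y \<in> carrier R" "w \<in> carrier R"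
  shows "w \<otimes> glue R f x y = glue R f (w \<otimes> x) (w \<otimes> y)"
  using f idempotentsD(1)[OF f] idempotent_compl(1,4)[OF f] c
  by (simp add: glue_def r_distr idempotent_left_commute[of _ w])

lemma glue_idempotents:
  assumes f: "f \<in> idempotents R" and "g \<in> idempotents R" "h \<in> idempotents R"
  shows "glue R f g h \<in> idempotents R"
proof -
  note fc = idempotentsD[OF f] and g = idempotentsD[OF assms(2)] and h = idempotentsD[OF assms(3)]
  have k: "glue R f g h \<in> carrier R" using fc g h by simp
  \<comment> \<open>Used with \<open>p = f\<close>, \<open>a = g\<close> and with
    \<open>p = 1 - f\<close>, \<open>a = h\<close>: on its component \<open>p\<close> the gluing
    agrees with the idempotent \<open>a\<close>, so multiplying by \<open>a\<close> changes nothing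
    there.\<close>
  have absorb: "p \<otimes> (a \<otimes> glue R f g h) = p \<otimes> glue R f g h"
    if "p \<in> idempotents R" "a \<in> idempotents R" "p \<otimes> glue R f g h = p \<otimes> a" for p a
  proof -
    have "p \<otimes> (a \<otimes> glue R f g h) = a \<otimes> (p \<otimes> a)"
      using that k idempotentsD(1)[OF that(2)] by (simp add: idempotent_left_commute[of p])
    also have "\<dots> = p \<otimes> a"
      using idempotentsD[OF that(1)] idempotentsD[OF that(2)] idempotent_left_commute[OF that(1), of a a]
      by simp
    finally show ?thesis using that(3) by simp
  qed
  have "glue R f (g \<otimes> glue R f g h) (h \<otimes> glue R f g h) = glue R f g h"
    using assms g h k idempotent_compl(4)[OF f]
    by (simp add: glue_eq_iff absorb idempotent_mult_glue)
  then show ?thesis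
    using fc g h k by (simp add: idempotents_def glue_mult_right)
qed

lemma annihilator_glue:
  assumes f: "f \<in> idempotents R" and g: "g \<in> idempotents R" and h: "h \<in> idempotents R"
    and x: "x \<in> carrier R" and y: "y \<in> carrier R"
    and ann: "annihilator R x = g <# carrier R" "annihilator R y = h <# carrier R"
  shows "annihilator R (glue R f x y) = glue R f g h <# carrier R"
proof -
  note fc = idempotentsD[OF f] and gc = idempotentsD[OF g] and hc = idempotentsD[OF h]
  let ?f = "\<one> \<ominus> f"
  note f' = idempotent_compl(4)[OF f]
  have "glue R f x y \<otimes> z = \<zero> \<longleftrightarrow> glue R f g h \<otimes> z = z" if z: "z \<in> carrier R" for z
  proof -
    \<comment> \<open>Centrality moves \<open>f\<close> and \<open>1 - f\<close> next to
      \<open>z\<close>, so that the hypotheses on the annihilators of \<open>x\<close> and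
      \<open>y\<close> apply to the elements \<open>f z\<close> and
      \<open>(1 - f) z\<close>.\<close>
    have "glue R f x y \<otimes> z = \<zero> \<longleftrightarrow> x \<otimes> (f \<otimes> z) = \<zero> \<and> y \<otimes> (?f \<otimes> z) = \<zero>"
      using fc x y z f idempotent_left_commute[OF f x z] idempotent_left_commute[OF f' y z]
      by (simp add: glue_mult_right glue_eq_iff)
    also have "\<dots> \<longleftrightarrow> g \<otimes> (f \<otimes> z) = f \<otimes> z \<and> h \<otimes> (?f \<otimes> z) = ?f \<otimes> z"
      using ann fc z by (simp add: annihilator_eq_coset_iff g h)
    also have "\<dots> \<longleftrightarrow> glue R f g h \<otimes> z = z"
      using fc gc hc z f idempotent_left_commute[OF f gc(1) z] idempotent_left_commute[OF f' hc(1) z]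
      by (simp add: glue_mult_right glue_eq_iff)
    finally show ?thesis .
  qed
  then show ?thesis
    by (simp add: annihilator_eq_coset_iff glue_idempotents f g h)
qed

end

section \<open>The subring of glued elements\<close>

text \<open>Each step may use its own idempotent from \<open>F\<close>, so two elements never have
  to be written over a common decomposition of the unit, and claims follow by structural
  induction.\<close>

inductive_set glued :: "('a, 'b) ring_scheme \<Rightarrow> 'a set \<Rightarrow> 'a set \<Rightarrow> 'a set"
  for S :: "('a, 'b) ring_scheme" and R F :: "'a set" where
  base: "r \<in> R \<Longrightarrow> r \<in> glued S R F"
| step: "\<lbrakk> f \<in> F; x \<in> glued S R F; y \<in> glued S R F \<rbrakk> \<Longrightarrow> glue S f x y \<in> glued S R F"

text \<open>Sums and products are handled by two inductions: first one operand is kept in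
  \<open>A\<close>, then this case serves as the base of an induction on the left operand.\<close>

lemma (in reduced_ring) subring_glued:
  assumes A: "subring A R" and F: "F \<subseteq> idempotents R"
  shows "subring (glued R A F) R"
proof -
  note AE = subringE[OF A]
  have Fc: "f \<in> carrier R" "f \<in> idempotents R" if "f \<in> F" for f
    using F that by (auto simp: idempotents_def)
  have closed: "x \<in> carrier R" if "x \<in> glued R A F" for x
    using that by induction (use AE(1) Fc in auto)
  have add_A: "x \<oplus> r \<in> glued R A F" if "x \<in> glued R A F" "r \<in> A" for x r
    using that
  proof induction
    case (step f x y)
    then show ?case
      using glued.step[OF step(1,4,5)] AE(1) closed Fc by (simp add: glue_add subset_eq)
  qed (auto intro: glued.base AE)
  have add: "x \<oplus> y \<in> glued R A F" if "x \<in> glued R A F" "y \<in> glued R A F" for x y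
    using that
  proof induction
    case (base r)
    then show ?case
      using add_A[of y r] closed AE(1) by (simp add: a_comm subset_eq)
  next
    case (step f x x')
    then show ?case
      using glued.step[OF step(1,4,5)] closed Fc by (simp add: glue_add)
  qed
  \<comment> \<open>The factor from \<open>A\<close> stands on the left, because the base case of
    \<open>mult\<close> has its left factor in \<open>A\<close> and the ring need not be
    commutative.\<close>
  have mult_A: "r \<otimes> x \<in> glued R A F" if "x \<in> glued R A F" "r \<in> A" for x r
    using that
  proof induction
    case (step f x y)
    then show ?case
      using glued.step[OF step(1,4,5)] AE(1) closed Fc by (simp add: glue_mult_left subset_eq)
  qed (auto intro: glued.base AE)
  have mult: "x \<otimes> y \<in> glued R A F" if "x \<in> glued R A F" "y \<in> glued R A F" for x y
    using that
  proof induction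
    case (base r)
    then show ?case using mult_A by simp
  next
    case (step f x x')
    then show ?case
      using glued.step[OF step(1,4,5)] closed Fc by (simp add: glue_mult_right)
  qed
  have minus: "\<ominus> x \<in> glued R A F" if "x \<in> glued R A F" for x
    using that
  proof induction
    case (step f x y)
    then show ?case
      using glued.step[OF step(1,4,5)] closed Fc by (simp add: glue_minus)
  qed (auto intro: glued.base AE)
  show ?thesis
    by (rule subringI) (auto intro: closed add mult minus glued.base AE)
qed

section \<open>Weakly Baer subrings\<close>

lemma (in reduced_ring) reduced_subring:
  assumes "subring A R"
  shows "reduced_ring (R\<lparr>carrier := A\<rparr>)"
proof -
  interpret A: ring "R\<lparr>carrier := A\<rparr>"
    using assms by (rule subring_is_ring)
  show ?thesis
  proof
    fix x and n :: nat
    assume "x \<in> carrier (R\<lparr>carrier := A\<rparr>)" "x [^]\<^bsub>R\<lparr>carrier := A\<rparr>\<^esub> n = \<zero>\<^bsub>R\<lparr>carrier := A\<rparr>\<^esub>"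
    then show "x = \<zero>\<^bsub>R\<lparr>carrier := A\<rparr>\<^esub>"
      using reduced[of x n] subringE(1)[OF assms] by (auto simp flip: nat_pow_consistent)
  qed
qed

text \<open>The elementwise criterion for \<open>g\<close> holds for all \<open>z\<close> of the
  large ring, hence for those in \<open>A\<close>, where product and zero are the same. Since
  \<open>g\<close> lies in \<open>A\<close>, this is the criterion inside the subring.\<close>

lemma (in reduced_ring) weakly_Baer_subring:
  assumes A: "subring A R"
    and ann: "\<And>t. t \<in> A \<Longrightarrow> \<exists>g \<in> idempotents R \<inter> A. annihilator R t = g <# carrier R"
  shows "weakly_Baer (R\<lparr>carrier := A\<rparr>)"
proof -
  note AE = subringE[OF A]
  interpret A: reduced_ring "R\<lparr>carrier := A\<rparr>"
    using A by (rule reduced_subring)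
  show ?thesis
  proof
    fix t assume "t \<in> carrier (R\<lparr>carrier := A\<rparr>)"
    then obtain g where g: "g \<in> idempotents R" "g \<in> A" "annihilator R t = g <# carrier R"
      using ann by auto
    then have gA: "g \<in> idempotents (R\<lparr>carrier := A\<rparr>)"
      by (simp add: idempotents_def)
    moreover have "annihilator (R\<lparr>carrier := A\<rparr>) t = g <#\<^bsub>R\<lparr>carrier := A\<rparr>\<^esub> carrier (R\<lparr>carrier := A\<rparr>)"
      using g(3) AE(1)
      by (intro A.annihilator_eq_coset_iff[OF gA, THEN iffD2])
        (simp add: annihilator_eq_coset_iff[OF g(1)] subset_eq)
    ultimately show "\<exists>g \<in> idempotents (R\<lparr>carrier := A\<rparr>).
        annihilator (R\<lparr>carrier := A\<rparr>) t = g <#\<^bsub>R\<lparr>carrier := A\<rparr>\<^esub> carrier (R\<lparr>carrier := A\<rparr>)"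
      by blast
  qed
qed

theorem proposition2p14:
  fixes S (structure) and R :: "'a set" and e :: "'a \<Rightarrow> 'a"
  assumes "weakly_Baer S"
    and "subring R S"
    and "reduced_ring (S\<lparr>carrier := R\<rparr>)"
    and "\<And>r. r \<in> R \<Longrightarrow> e r \<in> idempotents S"
    and "\<And>r. r \<in> R \<Longrightarrow> annihilator S r = e r <# carrier S"
  defines "T \<equiv> generate_ring S (R \<union> e ` R)"
  shows "weakly_Baer (S\<lparr>carrier := T\<rparr>)"
proof -
  interpret weakly_Baer S by fact
  note RE = subringE[OF assms(2)]
  have gens: "R \<union> e ` R \<subseteq> carrier S"
    using RE(1) assms(4) by (auto simp: idempotents_def)
  have T: "subring T S"
    unfolding T_def using gens by (rule generate_ring_is_subring)
  note TE = subringE[OF T]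
  have gens_T: "R \<subseteq> T" "e ` R \<subseteq> T"
    unfolding T_def by (auto intro: generate_ring.incl)
  let ?Q = "glued S R (e ` R)"
  have Q: "subring ?Q S"
    using assms(2,4) by (intro subring_glued) auto
  have "e r \<in> ?Q" if "r \<in> R" for r
  proof -
    have "glue S (e r) \<one> \<zero> \<in> ?Q"
      using that RE(2,3) by (auto intro: glued.intros)
    then show ?thesis
      using idempotentsD(1)[OF assms(4)[OF that]] by (simp add: glue_def)
  qed
  then have "T \<subseteq> ?Q"
    unfolding T_def by (intro generate_ring_min_subring1 gens Q) (auto intro: glued.base)
  \<comment> \<open>The element \<open>t\<close> ranges over \<open>?Q\<close>, which carries the
    induction, while \<open>g\<close> is required in \<open>T\<close>, as
    \<open>weakly_Baer_subring\<close> demands.\<close>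
  moreover have "\<exists>g \<in> idempotents S \<inter> T. annihilator S t = g <# carrier S" if "t \<in> ?Q" for t
    using that
  proof induction
    case (base r)
    then show ?case using assms(4,5) gens_T by blast
  next
    case (step f x y)
    then obtain g h where g: "g \<in> idempotents S" "g \<in> T" "annihilator S x = g <# carrier S"
      and h: "h \<in> idempotents S" "h \<in> T" "annihilator S y = h <# carrier S"
      by blast
    have f: "f \<in> idempotents S" "f \<in> T"
      using step(1) assms(4) gens_T by auto
    have "x \<in> carrier S" "y \<in> carrier S"
      using step(2,3) subringE(1)[OF Q] by auto
    then have "annihilator S (glue S f x y) = glue S f g h <# carrier S"
      using f g h by (intro annihilator_glue)
    \<comment> \<open>The idempotent \<open>f\<close> is some \<open>e r\<close> and so lies in
      \<open>T\<close>; a subring containing \<open>f\<close> is closed under gluing along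
      \<open>f\<close>.\<close>
    moreover have "glue S f g h \<in> T"
      using f g h TE by (simp add: glue_def a_minus_def)
    ultimately show ?case
      using glue_idempotents f g h by blast
  qed
  ultimately show ?thesis
    using T by (intro weakly_Baer_subring) auto
qed

end
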